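(* For all $u\in\mathbb{C}$ with $0<|u|$ sufficiently small, \[n\!\left(\frac{27u(1+u)^4}{2(1+4u+u^2)^3}\right)+n\!\left(-\frac{27u(1+u)}{2(1-2u-2u^2)^3}\right)=2\,n\!\left(\frac{27u^4(1+u)}{2(2+2u-u^2)^3}\right)-3\,n\!\left(\frac{27u^2(1+u)^2}{4(1+u+u^2)^3}\right).\]
   Context: $n(t)=\mathrm{m}\!\left(x^3+y^3+1-\frac{3}{t^{1/3}}xy\right)$, where $\mathrm{m}$ is the logarithmic Mahler measure $\mathrm{m}(P)=\int_0^1\int_0^1\log|P(e^{2\pi i\theta_1},e^{2\pi i\theta_2})|d\theta_1d\theta_2$ (independent of the choice of cube root). *)

theory Defs
  imports "HOL-Analysis.Analysis"
begin

definition mahler2 :: "(complex \<Rightarrow> complex \<Rightarrow> complex) \<Rightarrow> real" where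
  "mahler2 P = (\<integral>\<theta>\<in>{0..1} \<times> {0..1}.
      ln (cmod (P (cis (2 * pi * fst \<theta>)) (cis (2 * pi * snd \<theta>)))) \<partial>(lborel \<Otimes>\<^sub>M lborel))"

text \<open>\<open>n(t) = m(x^3 + y^3 + 1 - (3 / t^{1/3}) x y)\<close>; we use the principal cube root
  \<open>t powr (1/3)\<close> (the value is independent of the choice of cube root).\<close>
definition nfun :: "complex \<Rightarrow> real" where
  "nfun t = mahler2 (\<lambda>x y. x ^ 3 + y ^ 3 + 1 - (3 / t powr (1/3)) * x * y)"

end

theory Submission
  imports Defs
begin

text \<open>
  Expanding the logarithm under the integral gives, for \<open>0 < |t| < 1\<close>,
  \<open>n(t) = log 3 - (log |t|) / 3 - Re \<Phi>(t) / 3\<close> with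
  \<open>\<Phi>(t) = \<Sum>j\<ge>1. (3j)! / (j!\<^sup>3 27\<^sup>j) t\<^sup>j / j\<close>, and \<open>F = 1 + t \<Phi>'\<close> is the hypergeometric
  function \<open>\<^sub>2F\<^sub>1(1/3, 2/3; 1; t)\<close>, which solves \<open>(t (1 - t) F')' = (2/9) F\<close>.
  Each of the four arguments has the form \<open>t = N(u) / r(u)\<^sup>3\<close>, and \<open>F(t) / r\<close> is a solution, with
  value \<open>1\<close> at the regular singular point \<open>0\<close>, of one and the same equation \<open>(p H')' = q H\<close>, where
  \<open>p = u (1 + u) (1 - u) (1 + 2u) (2 + u)\<close> and \<open>q = 8u\<^sup>3 + 12u\<^sup>2 - 2\<close>; so the four quotients coincide.
  Writing \<open>H\<close> for the common value, \<open>F(t) dt / t\<close> equals \<open>H(u) M(u) du / (u (1 + u))\<close> with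
  \<open>M = (1 - u)\<^sup>3\<close>, \<open>(1 + 2u)\<^sup>3\<close>, \<open>(2 + u)\<^sup>3 / 2\<close>, \<open>(1 - u) (1 + 2u) (2 + u)\<close>, and the weighted sum of
  these vanishes because \<open>x\<^sup>3 + y\<^sup>3 + z\<^sup>3 = 3 x y z\<close> whenever \<open>x + y + z = 0\<close>.
\<close>

section \<open>The hypergeometric series\<close>

text \<open>Up to the power of 27 this is \<open>(3j)! / j!^3\<close>, the constant term of
  \<open>((x^3 + y^3 + 1) / (x y))^(3j)\<close>; the product of binomials is the form in which a
  repeated binomial expansion delivers it.\<close>

definition cubic_coeff :: "nat \<Rightarrow> complex" where
  "cubic_coeff j = of_nat ((3 * j choose j) * (2 * j choose j)) / 27 ^ j"

lemma cubic_coeff_0 [simp]: "cubic_coeff 0 = 1"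
  by (simp add: cubic_coeff_def)

lemma cubic_coeff_fact: "cubic_coeff j = fact (3 * j) / (fact j ^ 3 * 27 ^ j)"
proof -
  have "of_nat (3 * j choose j) = (fact (3 * j) / (fact j * fact (2 * j)) :: complex)"
    by (subst binomial_fact) (auto simp: algebra_simps)
  moreover have "of_nat (2 * j choose j) = (fact (2 * j) / (fact j * fact j) :: complex)"
    by (subst binomial_fact) (auto simp: algebra_simps mult_2)
  ultimately show ?thesis
    by (simp add: cubic_coeff_def power3_eq_cube)
qed

text \<open>This is the hypergeometric ratio \<open>(j + 1/3) (j + 2/3) / (j + 1)^2\<close> of
  consecutive terms, with denominators cleared.\<close>

lemma cubic_coeff_Suc:
  "9 * of_nat (Suc j) ^ 2 * cubic_coeff (Suc j) =
     of_nat (9 * j ^ 2 + 9 * j + 2) * cubic_coeff j"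
proof -
  have nz: "of_nat (Suc j) \<noteq> (0 :: complex)"
    using of_nat_neq_0 by blast
  have e: "3 * Suc j = Suc (Suc (Suc (3 * j)))" by simp
  have "fact (3 * Suc j) = (of_nat (3 * j + 3) * of_nat (3 * j + 2) * of_nat (3 * j + 1) * fact (3 * j) :: complex)"
    unfolding e fact_Suc by (simp add: algebra_simps)
  also have "of_nat (3 * j + 3) = (3 * of_nat (Suc j) :: complex)" by simp
  finally have f: "fact (3 * Suc j) = (3 * of_nat (Suc j) * of_nat (3 * j + 2) * of_nat (3 * j + 1) * fact (3 * j) :: complex)" .
  have aux: "9 * x ^ 2 * (3 * x * a * b * c / ((x * d) ^ 3 * (27 * e))) = a * b * (c / (d ^ 3 * e))"
    if "x \<noteq> 0" for x a b c d e :: complex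
    using that by (simp add: field_simps power2_eq_square power3_eq_cube)
  have "9 * of_nat (Suc j) ^ 2 * cubic_coeff (Suc j) =
      of_nat (3 * j + 2) * of_nat (3 * j + 1) * cubic_coeff j"
    unfolding cubic_coeff_fact f fact_Suc power_Suc by (rule aux[OF nz])
  also have "of_nat (3 * j + 2) * of_nat (3 * j + 1) = (of_nat (9 * j ^ 2 + 9 * j + 2) :: complex)"
    unfolding of_nat_mult[symmetric] by (simp add: algebra_simps power2_eq_square)
  finally show ?thesis .
qed

text \<open>The recurrence never increases the modulus, since
  \<open>9 j^2 + 9 j + 2 <= 9 (j + 1)^2\<close>. Convergence of both power series in the unit disc
  rests on this bound.\<close>

lemma norm_cubic_coeff_le: "norm (cubic_coeff j) \<le> 1"
proof (induction j)
  case (Suc j)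
  have "9 * real (Suc j) ^ 2 * norm (cubic_coeff (Suc j)) =
      norm (9 * of_nat (Suc j) ^ 2 * cubic_coeff (Suc j))"
    by (simp only: norm_mult norm_power norm_of_nat norm_numeral)
  also have "\<dots> = real (9 * j ^ 2 + 9 * j + 2) * norm (cubic_coeff j)"
    by (simp only: cubic_coeff_Suc norm_mult norm_of_nat)
  also have "\<dots> \<le> real (9 * j ^ 2 + 9 * j + 2) * 1"
    by (intro mult_left_mono Suc) auto
  also have "\<dots> \<le> 9 * real (Suc j) ^ 2 * 1"
    by (simp add: power2_eq_square algebra_simps)
  finally show ?case
    by (rule mult_left_le_imp_le) simp
qed auto

lemma conv_radius_ge_1:
  fixes f :: "nat \<Rightarrow> complex"
  assumes "\<And>n. norm (f n) \<le> 1"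
  shows "1 \<le> fps_conv_radius (Abs_fps f)"
  unfolding fps_conv_radius_def
proof (rule conv_radius_geI_ex)
  fix r :: real assume r: "0 < r" "ereal r < 1"
  have "summable (\<lambda>n. f n * of_real r ^ n)"
  proof (rule summable_comparison_test')
    show "summable (\<lambda>n. r ^ n)"
      using r by (intro summable_geometric) auto
    show "norm (f n * of_real r ^ n) \<le> r ^ n" if "n \<ge> 0" for n
      using assms[of n] r mult_right_mono[of "norm (f n)" 1 "r ^ n"]
      by (simp add: norm_mult norm_power)
  qed
  then show "\<exists>z. norm z = r \<and> summable (\<lambda>n. fps_nth (Abs_fps f) n * z ^ n)"
    using r by (intro exI[of _ "of_real r"]) auto
qed

lemma norm_less_radius:
  assumes "norm t < 1" "1 \<le> R"
  shows "ereal (norm t) < R"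
  using assms by (auto intro: less_le_trans[of _ 1])

definition cubic_fps :: "complex fps" where
  "cubic_fps = Abs_fps cubic_coeff"

text \<open>The coefficient at \<open>0\<close> is \<open>1 / 0 = 0\<close>.\<close>
definition cubic_log_fps :: "complex fps" where
  "cubic_log_fps = Abs_fps (\<lambda>n. cubic_coeff n / of_nat n)"

definition cubicF :: "complex \<Rightarrow> complex" where
  "cubicF = eval_fps cubic_fps"

definition cubicPhi :: "complex \<Rightarrow> complex" where
  "cubicPhi = eval_fps cubic_log_fps"

lemma cubic_fps_radius: "1 \<le> fps_conv_radius cubic_fps"
  unfolding cubic_fps_def by (intro conv_radius_ge_1 norm_cubic_coeff_le)

lemma cubic_log_fps_radius: "1 \<le> fps_conv_radius cubic_log_fps"
  unfolding cubic_log_fps_def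
proof (rule conv_radius_ge_1)
  fix n
  show "norm (cubic_coeff n / of_nat n) \<le> 1"
    using norm_cubic_coeff_le[of n] 
    by (cases "n = 0") (auto simp: norm_divide field_simps)
qed

lemma cubicF_0 [simp]: "cubicF 0 = 1"
  by (simp add: cubicF_def eval_fps_at_0 cubic_fps_def)

lemma cubicPhi_0 [simp]: "cubicPhi 0 = 0"
  by (simp add: cubicPhi_def eval_fps_at_0 cubic_log_fps_def)

lemma cubicPhi_sums:
  assumes "norm t < 1"
  shows "(\<lambda>n. cubic_coeff n / of_nat n * t ^ n) sums cubicPhi t"
  using sums_eval_fps[OF norm_less_radius[OF assms cubic_log_fps_radius]]
  by (simp add: cubicPhi_def cubic_log_fps_def)

text \<open>The operator \<open>t d/dt\<close> cancels the factor \<open>1 / n\<close> in each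
  coefficient and loses only the constant term. Describing \<open>D\<close> through
  \<open>t * D\<close> avoids a division at \<open>t = 0\<close>.\<close>

lemma cubicPhi_has_derivative:
  assumes "norm t < 1"
  obtains D where "(cubicPhi has_field_derivative D) (at t)" "t * D = cubicF t - 1"
proof
  have r: "ereal (norm t) < fps_conv_radius cubic_log_fps" "ereal (norm t) < fps_conv_radius cubic_fps"
    by (intro norm_less_radius assms cubic_log_fps_radius cubic_fps_radius)+
  show "(cubicPhi has_field_derivative eval_fps (fps_deriv cubic_log_fps) t) (at t)"
    unfolding cubicPhi_def using r by (intro has_field_derivative_eval_fps) auto
  have "fps_X * fps_deriv cubic_log_fps = cubic_fps - 1"
  proof (rule fps_ext)
    fix n
    show "fps_nth (fps_X * fps_deriv cubic_log_fps) n = fps_nth (cubic_fps - 1) n"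
      using of_nat_neq_0[of "n - 1", where 'a = complex]
      by (cases n) (auto simp: cubic_log_fps_def cubic_fps_def)
  qed
  then have "eval_fps (fps_X * fps_deriv cubic_log_fps) t = eval_fps (cubic_fps - 1) t"
    by simp
  then show "t * eval_fps (fps_deriv cubic_log_fps) t = cubicF t - 1"
    using r fps_conv_radius_deriv[of cubic_log_fps]
    by (subst (asm) eval_fps_mult) (auto simp: eval_fps_diff cubicF_def intro: less_le_trans)
qed

definition cubicF' :: "complex \<Rightarrow> complex" where
  "cubicF' = eval_fps (fps_deriv cubic_fps)"

lemma cubicF_has_derivative:
  assumes "norm t < 1"
  shows "(cubicF has_field_derivative cubicF' t) (at t)"
  unfolding cubicF_def cubicF'_def 
  by (intro has_field_derivative_eval_fps norm_less_radius assms cubic_fps_radius)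

text \<open>Comparing coefficients turns the equation into \<open>cubic_coeff_Suc\<close>. The
  divergence form remains meaningful at the singular point 0 and needs no name for the second
  derivative.\<close>

lemma cubicF_ode:
  assumes "norm t < 1"
  shows "((\<lambda>t. t * (1 - t) * cubicF' t) has_field_derivative (2 / 9) * cubicF t) (at t)"
proof -
  define G where "G = fps_X * (1 - fps_X) * fps_deriv cubic_fps"
  have rA: "1 \<le> fps_conv_radius (fps_deriv cubic_fps)"
    using fps_conv_radius_deriv[of cubic_fps] cubic_fps_radius by (rule order_trans[rotated])
  have rX: "fps_conv_radius (fps_X * (1 - fps_X :: complex fps)) = \<infinity>"
    using fps_conv_radius_mult[of fps_X "1 - fps_X :: complex fps"] 
      fps_conv_radius_diff[of 1 "fps_X :: complex fps"] by simp
  have rG: "1 \<le> fps_conv_radius G"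
    unfolding G_def by (rule order_trans[OF _ fps_conv_radius_mult]) (use rA rX in auto)
  have G: "eval_fps G z = z * (1 - z) * cubicF' z" if "norm z < 1" for z
  proof -
    have "ereal (norm z) < fps_conv_radius (fps_deriv cubic_fps)"
      by (intro norm_less_radius that rA)
    moreover have "eval_fps (fps_X * (1 - fps_X)) z = z * (1 - z)"
    proof (subst eval_fps_mult)
      show "ereal (norm z) < fps_conv_radius (1 - fps_X :: complex fps)"
        using fps_conv_radius_diff[of 1 "fps_X :: complex fps"] by simp
    qed (auto simp: eval_fps_diff)
    ultimately show ?thesis
      unfolding G_def by (subst eval_fps_mult) (auto simp: rX cubicF'_def)
  qed
  have "fps_deriv G = fps_const (2 / 9) * cubic_fps"
  proof (rule fps_ext)
    fix n
    let ?a = cubic_coeff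
    have GG: "G = fps_X * fps_deriv cubic_fps - fps_X * (fps_X * fps_deriv cubic_fps)"
      by (simp add: G_def algebra_simps)
    have "fps_nth (fps_deriv G) n = of_nat (n + 1) * (of_nat (n + 1) * ?a (n + 1) - of_nat n * ?a n)"
      unfolding GG fps_deriv_nth fps_sub_nth
      by (cases n) (auto simp: cubic_fps_def)
    also have "\<dots> = 2 / 9 * ?a n"
      using cubic_coeff_Suc[of n] by (simp add: field_simps power2_eq_square)
    finally show "fps_nth (fps_deriv G) n = fps_nth (fps_const (2 / 9) * cubic_fps) n"
      by (simp add: cubic_fps_def)
  qed
  then have "eval_fps (fps_deriv G) t = 2 / 9 * cubicF t"
    by (simp add: eval_fps_mult cubicF_def norm_less_radius[OF assms cubic_fps_radius])
  moreover have "(eval_fps G has_field_derivative eval_fps (fps_deriv G) t) (at t)"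
    by (intro has_field_derivative_eval_fps norm_less_radius assms rG)
  ultimately have "(eval_fps G has_field_derivative (2 / 9) * cubicF t) (at t)"
    by (simp only:)
  then show ?thesis
    by (rule has_field_derivative_transform_within_open[of _ _ _ "ball 0 1"]) (use assms G in auto)
qed

section \<open>Logarithmic Mahler measure as a series\<close>

lemma integral_cis_int:
  "integral {0..1} (\<lambda>x. cis (2 * pi * of_int m * x)) = (if m = 0 then 1 else 0)"
proof (cases "m = 0")
  case False
  define a where "a = \<i> * of_real (2 * pi * of_int m)"
  have a: "a \<noteq> 0"
    using False by (simp add: a_def)
  have cis: "cis (2 * pi * of_int m * x) = exp (a * of_real x)" for x
    by (simp add: cis_conv_exp a_def mult_ac)
  have "((\<lambda>x. exp (a * of_real x)) has_integral
      (exp (a * of_real 1) / a - exp (a * of_real 0) / a)) {0..1}"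
  proof (rule fundamental_theorem_of_calculus)
    fix x :: real
    have "((\<lambda>z. exp (a * z) / a) has_field_derivative exp (a * of_real x)) (at (of_real x))"
      using a by (auto intro!: derivative_eq_intros)
    then show "((\<lambda>x. exp (a * of_real x) / a) has_vector_derivative exp (a * of_real x)) (at x within {0..1})"
      by (rule has_vector_derivative_real_field)
  qed auto
  then have "((\<lambda>x. cis (2 * pi * of_int m * x)) has_integral
      (cis (2 * pi * of_int m * 1) / a - cis (2 * pi * of_int m * 0) / a)) {0..1}"
    unfolding cis .
  moreover have "cis (2 * pi * of_int m) = 1"
    by (rule cis_multiple_2pi) auto
  ultimately show ?thesis
    using False by (simp add: integral_unique)
qed auto

lemma integral_cis_prod:
  "((\<lambda>\<theta>. cis (2 * pi * of_int m * fst \<theta>) * cis (2 * pi * of_int n * snd \<theta>))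
     has_integral (if m = 0 \<and> n = 0 then 1 else 0)) (cbox (0, 0) (1, 1 :: real))"
proof -
  let ?f = "\<lambda>\<theta>. cis (2 * pi * of_int m * fst \<theta>) * cis (2 * pi * of_int n * snd \<theta>)"
  have c: "continuous_on (cbox (0, 0) (1, 1 :: real)) ?f"
    by (intro continuous_intros)
  have "integral (cbox (0, 0) (1, 1)) ?f =
      integral {0..1} (\<lambda>x. cis (2 * pi * of_int m * x)) * integral {0..1} (\<lambda>x. cis (2 * pi * of_int n * x))"
    by (subst integral_prod_continuous[OF c]) (simp add: integral_mult_right integral_mult_left)
  also have "\<dots> = (if m = 0 \<and> n = 0 then 1 else 0)"
    by (simp add: integral_cis_int)
  finally show ?thesis
    using integrable_continuous[OF c] by (simp add: has_integral_iff)
qed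

lemma cis_power_divide: "cis a ^ p / cis a ^ n = cis (of_int (int p - int n) * a)"
  by (simp add: Complex.DeMoivre cis_divide algebra_simps)

text \<open>On the torus \<open>x^3 + y^3 + 1 - k x y = - k x y (1 - torus_arg / k)\<close>, and the
  prefactor has constant modulus, so only the moments of this Laurent polynomial matter.\<close>

abbreviation torus_arg :: "real \<times> real \<Rightarrow> complex" where
  "torus_arg \<theta> \<equiv> (cis (2 * pi * fst \<theta>) ^ 3 + cis (2 * pi * snd \<theta>) ^ 3 + 1)
      / (cis (2 * pi * fst \<theta>) * cis (2 * pi * snd \<theta>))"

text \<open>Two binomial expansions produce the monomials \<open>x^(3i - n) y^(3j - n)\<close>; by
  orthogonality only \<open>i = j = n / 3\<close> contributes.\<close>

lemma torus_moment:
  "((\<lambda>\<theta>. torus_arg \<theta> ^ n) has_integral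
     (if 3 dvd n then of_nat ((n choose (n div 3)) * ((n - n div 3) choose (n div 3))) else 0))
     (cbox (0, 0) (1, 1))"
proof -
  define c where "c i j = (of_nat ((n choose i) * ((n - i) choose j)) :: complex)" for i j
  have expand: "torus_arg \<theta> ^ n = (\<Sum>i\<le>n. \<Sum>j\<le>n - i. c i j *
      (cis (2 * pi * of_int (3 * int i - int n) * fst \<theta>) *
       cis (2 * pi * of_int (3 * int j - int n) * snd \<theta>)))" for \<theta>
  proof -
    define x where "x = cis (2 * pi * fst \<theta>)"
    define y where "y = cis (2 * pi * snd \<theta>)"
    have "(x ^ 3 + y ^ 3 + 1) ^ n = (x ^ 3 + (y ^ 3 + 1)) ^ n"
      by (simp add: add.assoc)
    also have "\<dots> = (\<Sum>i\<le>n. of_nat (n choose i) * (x ^ 3) ^ i * (y ^ 3 + 1) ^ (n - i))"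
      by (rule binomial_ring)
    also have "\<dots> = (\<Sum>i\<le>n. \<Sum>j\<le>n - i. c i j * (x ^ (3 * i) * y ^ (3 * j)))"
      unfolding binomial_ring[of "y ^ 3" 1]
      by (simp add: c_def sum_distrib_left mult_ac flip: power_mult)
    finally have "((x ^ 3 + y ^ 3 + 1) / (x * y)) ^ n =
        (\<Sum>i\<le>n. \<Sum>j\<le>n - i. c i j * (x ^ (3 * i) / x ^ n * (y ^ (3 * j) / y ^ n)))"
      by (simp add: power_divide power_mult_distrib sum_divide_distrib)
    then show ?thesis
      unfolding x_def y_def cis_power_divide by (simp add: mult_ac)
  qed
  have "((\<lambda>\<theta>. torus_arg \<theta> ^ n) has_integral
      (\<Sum>i\<le>n. \<Sum>j\<le>n - i. c i j * (if 3 * int i - int n = 0 \<and> 3 * int j - int n = 0 then 1 else 0)))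
      (cbox (0, 0) (1, 1))"
    unfolding expand
    by (intro has_integral_sum has_integral_mult_right integral_cis_prod finite_atMost)
  also have "(\<Sum>i\<le>n. \<Sum>j\<le>n - i. c i j * (if 3 * int i - int n = 0 \<and> 3 * int j - int n = 0 then 1 else 0))
     = (if 3 dvd n then of_nat ((n choose (n div 3)) * ((n - n div 3) choose (n div 3))) else 0)"
  proof (cases "3 dvd n")
    case False
    then have "\<not> (3 * int i - int n = 0 \<and> 3 * int j - int n = 0)" for i j
      by presburger
    then show ?thesis
      using False by (simp only: if_False) simp
  next
    case True
    then obtain k where k: "n = 3 * k" ..
    have "(\<Sum>i\<le>n. \<Sum>j\<le>n - i. c i j * (if 3 * int i - int n = 0 \<and> 3 * int j - int n = 0 then 1 else 0))
        = (\<Sum>i\<le>n. if i = k then (\<Sum>j\<le>n - i. if j = k then c i j else 0) else 0)"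
      by (intro sum.cong refl) (auto simp: k if_distrib[of "(*) _"] cong: if_cong)
    also have "\<dots> = c k k"
      by (simp add: k)
    finally show ?thesis
      using True by (simp add: k c_def)
  qed
  finally show ?thesis .
qed

lemma norm_torus_arg_le: "norm (torus_arg \<theta>) \<le> 3"
proof -
  have "norm (cis (2 * pi * fst \<theta>) ^ 3 + cis (2 * pi * snd \<theta>) ^ 3 + 1) \<le> 1 + 1 + 1"
    by (intro norm_triangle_mono) (auto simp: norm_power)
  then show ?thesis
    by (simp add: norm_divide norm_mult)
qed

text \<open>Since \<open>torus_arg\<close> is bounded by 3, the logarithmic series converges
  uniformly and can be integrated term by term. The surviving exponents \<open>n = 3j\<close> carry
  the weight \<open>1 / (3j)\<close>, whence the factor \<open>1 / 3\<close>.\<close>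

lemma integral_ln_torus:
  assumes k: "norm k > 3"
  shows "((\<lambda>\<theta>. Ln (1 - torus_arg \<theta> / k)) has_integral - cubicPhi (27 / k ^ 3) / 3)
          (cbox (0, 0) (1, 1))"
proof -
  let ?B = "cbox (0, 0) (1, 1 :: real) :: (real \<times> real) set"
  define \<rho> where "\<rho> = 3 / norm k"
  have \<rho>: "0 \<le> \<rho>" "\<rho> < 1"
    using k by (auto simp: \<rho>_def divide_simps)
  have le: "norm (torus_arg \<theta> / k) \<le> \<rho>" for \<theta>
    unfolding \<rho>_def norm_divide[of _ k] by (intro divide_right_mono norm_torus_arg_le) auto
  have k0: "k \<noteq> 0" using k by auto
  \<comment> \<open>Division by \<open>of_nat 0\<close> yields 0, so the term \<open>n = 0\<close>
    vanishes and the logarithmic series can be summed from 0.\<close>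
  define f where "f N \<theta> = (\<Sum>n<N. - ((torus_arg \<theta> / k) ^ n) / of_nat n)" for N and \<theta> :: "real \<times> real"
  have sums: "(\<lambda>n. - ((torus_arg \<theta> / k) ^ n) / of_nat n) sums Ln (1 - torus_arg \<theta> / k)" for \<theta>
    using Ln_series'[of "- (torus_arg \<theta> / k)"] le[of \<theta>] \<rho> by simp
  have lim: "uniform_limit ?B f (\<lambda>\<theta>. Ln (1 - torus_arg \<theta> / k)) sequentially"
  proof -
    have "uniform_limit ?B f (\<lambda>\<theta>. \<Sum>n. - ((torus_arg \<theta> / k) ^ n) / of_nat n) sequentially"
      unfolding f_def
    proof (rule Weierstrass_m_test)
      show "summable (\<lambda>n. \<rho> ^ n)"
        using \<rho> by (intro summable_geometric) auto
      fix n and \<theta> :: "real \<times> real"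
      have "norm (- ((torus_arg \<theta> / k) ^ n) / of_nat n) = norm (torus_arg \<theta> / k) ^ n / real n"
        by (simp only: norm_divide norm_minus_cancel norm_power norm_of_nat)
      also have "\<dots> \<le> norm (torus_arg \<theta> / k) ^ n"
        by (cases "n = 0") (auto simp: divide_le_eq intro!: mult_right_le_one_le mult_le_cancel_left1[THEN iffD2])
      also have "\<dots> \<le> \<rho> ^ n"
        by (intro power_mono le) auto
      finally show "norm (- ((torus_arg \<theta> / k) ^ n) / of_nat n) \<le> \<rho> ^ n" .
    qed
    then show ?thesis
      using sums by (simp add: sums_iff)
  qed
  have cont: "continuous_on ?B (f N)" for N
  proof -
    \<comment> \<open>Multiplying by a constant instead of dividing by \<open>of_nat n\<close>
      spares the continuity proof a nonvanishing condition that fails at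
      \<open>n = 0\<close>.\<close>
    define c where "c n = - 1 / (k ^ n * of_nat n)" for n
    have "f N = (\<lambda>\<theta>. \<Sum>n<N. torus_arg \<theta> ^ n * c n)"
      by (rule ext) (simp add: f_def c_def power_divide power_mult_distrib mult_ac)
    moreover have "continuous_on ?B (\<lambda>\<theta>. \<Sum>n<N. torus_arg \<theta> ^ n * c n)"
      by (intro continuous_intros) auto
    ultimately show ?thesis by simp
  qed
  obtain I J where I: "\<And>n. (f n has_integral I n) ?B"
    and J: "((\<lambda>\<theta>. Ln (1 - torus_arg \<theta> / k)) has_integral J) ?B" and IJ: "I \<longlonglongrightarrow> J"
    using uniform_limit_integral_cbox[OF lim cont] by auto
  define m where "m n = (if 3 dvd n then of_nat ((n choose (n div 3)) * ((n - n div 3) choose (n div 3))) else 0 :: complex)" for n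
  define g where "g n = - (m n / k ^ n) / of_nat n" for n
  have "(f N has_integral (\<Sum>n<N. g n)) ?B" for N
    unfolding f_def g_def power_divide[of _ k]
    by (intro has_integral_sum has_integral_divide has_integral_neg finite_lessThan)
       (use torus_moment in \<open>auto simp: m_def\<close>)
  then have "I = (\<lambda>N. \<Sum>n<N. g n)"
    by (intro ext has_integral_unique[OF I])
  then have "g sums J"
    using IJ by (simp add: sums_def)
  moreover have "g n = 0" if "n \<notin> range ((*) 3)" for n
    using that by (auto simp: g_def m_def dvd_def)
  ultimately have "(\<lambda>j. g (3 * j)) sums J"
    by (subst sums_mono_reindex) (auto simp: strict_mono_def)
  moreover have "g (3 * j) = - (cubic_coeff j / of_nat j * (27 / k ^ 3) ^ j) / 3" for j
    using k0 by (simp add: g_def m_def cubic_coeff_def power_divide field_simps flip: power_mult)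
  moreover have "norm (27 / k ^ 3) < 1"
  proof -
    have "3 ^ 3 < norm k ^ 3"
      using k by (intro power_strict_mono) auto
    then show ?thesis
      by (simp add: norm_divide norm_power divide_simps)
  qed
  then have "(\<lambda>j. - (cubic_coeff j / of_nat j * (27 / k ^ 3) ^ j) / 3) sums (- cubicPhi (27 / k ^ 3) / 3)"
    by (intro sums_divide sums_minus cubicPhi_sums)
  ultimately have "J = - cubicPhi (27 / k ^ 3) / 3"
    by (simp add: sums_iff)
  then show ?thesis using J by simp
qed

text \<open>For \<open>k = 3 / t^(1/3)\<close> the condition \<open>|t| < 1\<close> becomes
  \<open>|k| > 3\<close>, and \<open>27 / k^3 = t\<close>. The summand \<open>ln |k|\<close> comes
  from the prefactor \<open>- k x y\<close>.\<close>

lemma nfun_eq: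
  assumes t: "t \<noteq> 0" "norm t < 1"
  shows "nfun t = ln 3 - ln (norm t) / 3 - Re (cubicPhi t) / 3"
proof -
  let ?B = "cbox (0, 0) (1, 1 :: real) :: (real \<times> real) set"
  define s where "s = t powr (1 / 3)"
  define k where "k = 3 / s"
  have s3: "s ^ 3 = t"
    using t by (simp add: s_def powr_def flip: exp_of_nat_mult)
  have s0: "s \<noteq> 0" using s3 t by auto
  have norm_s: "norm s ^ 3 = norm t"
    by (simp add: s3 flip: norm_power)
  have "norm s < 1"
    using norm_s t power_less_one_iff[of "norm s" 3] by simp
  then have k: "norm k > 3"
    using s0 by (simp add: k_def norm_divide divide_simps)
  have k0: "k \<noteq> 0" using k by auto
  have k3: "27 / k ^ 3 = t"
    using s0 by (simp add: k_def power_divide s3)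
  have lnk: "ln (norm k) = ln 3 - ln (norm t) / 3"
  proof -
    have "ln (norm t) = 3 * ln (norm s)"
      using s0 by (simp add: ln_realpow flip: norm_s)
    then show ?thesis
      using s0 by (simp add: k_def norm_divide ln_div)
  qed
  let ?P = "\<lambda>\<theta>. cis (2 * pi * fst \<theta>) ^ 3 + cis (2 * pi * snd \<theta>) ^ 3 + 1
      - k * cis (2 * pi * fst \<theta>) * cis (2 * pi * snd \<theta>)"
  have le: "norm (torus_arg \<theta> / k) < 1" for \<theta>
  proof -
    have "norm (torus_arg \<theta>) < norm k"
      using norm_torus_arg_le k by (rule le_less_trans)
    then show ?thesis
      using k0 by (simp only: norm_divide[of _ k] divide_less_eq) simp
  qed
  have ne: "1 - torus_arg \<theta> / k \<noteq> 0" for \<theta>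
    using le[of \<theta>] by auto
  have P: "norm (?P \<theta>) = norm k * norm (1 - torus_arg \<theta> / k)" for \<theta>
  proof -
    have "?P \<theta> = - (k * (cis (2 * pi * fst \<theta>) * cis (2 * pi * snd \<theta>)) * (1 - torus_arg \<theta> / k))"
      using k0 by (simp add: field_simps)
    then show ?thesis
      by (simp only: norm_minus_cancel norm_mult norm_cis mult_1_right)
  qed
  have lnP: "ln (norm (?P \<theta>)) = ln (norm k) + Re (Ln (1 - torus_arg \<theta> / k))" for \<theta>
    unfolding P using ne[of \<theta>] k0 by (simp add: ln_mult Re_Ln)
  have "((\<lambda>\<theta>. ln (norm (?P \<theta>))) has_integral (ln (norm k) + Re (- cubicPhi t / 3))) ?B"
    unfolding lnP
  proof (rule has_integral_add)
    show "((\<lambda>\<theta>. ln (norm k)) has_integral ln (norm k)) ?B"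
      using has_integral_const[of "ln (norm k)" "(0, 0)" "(1, 1 :: real) :: real \<times> real"]
      by (simp add: content_Pair)
    show "((\<lambda>\<theta>. Re (Ln (1 - torus_arg \<theta> / k))) has_integral Re (- cubicPhi t / 3)) ?B"
      using has_integral_linear[OF integral_ln_torus[OF k] bounded_linear_Re] by (simp add: o_def k3)
  qed
  then have "integral ?B (\<lambda>\<theta>. ln (norm (?P \<theta>))) = ln 3 - ln (norm t) / 3 - Re (cubicPhi t) / 3"
    by (simp add: integral_unique lnk)
  moreover have "nfun t = integral ?B (\<lambda>\<theta>. ln (norm (?P \<theta>)))"
  proof -
    have B: "{0..1} \<times> {0..1} = ?B"
      by (simp add: cbox_Pair_eq)
    \<comment> \<open>Having no zero on the torus, the polynomial gives a continuous integrand on a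
      compact square, so the Lebesgue integral of the definition agrees with the gauge integral
      computed above.\<close>
    have Pne: "?P \<theta> \<noteq> 0" for \<theta>
      using P[of \<theta>] ne[of \<theta>] k0 by (metis mult_eq_0_iff norm_eq_zero)
    have "continuous_on ?B (\<lambda>\<theta>. ln (norm (?P \<theta>)))"
      using Pne by (intro continuous_intros) auto
    then have "set_integrable lborel ?B (\<lambda>\<theta>. ln (norm (?P \<theta>)))"
      by (intro borel_integrable_compact[folded set_integrable_def]) auto
    then show ?thesis
      unfolding nfun_def mahler2_def lborel_prod B
      using set_borel_integral_eq_integral(2) by (simp add: k_def s_def)
  qed
  ultimately show ?thesis by simp
qed

section \<open>Pullbacks of the hypergeometric equation\<close>

text \<open>For \<open>t = N / r^3\<close>, \<open>eq1\<close> says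
  \<open>c p t' = t (1 - t) r^2\<close>, which makes the \<open>F'\<close> terms of
  \<open>(p H')'\<close> cancel; \<open>eq2\<close> says that the remaining coefficient of
  \<open>F\<close> is \<open>q / r\<close>. Both are cleared of denominators, so that they become
  polynomial identities in the applications.\<close>

lemma cubicF_pullback_ode:
  fixes N N1 r r1 r2 p p1 q :: "complex \<Rightarrow> complex"
  assumes "open S" "c \<noteq> 0"
    and N: "\<And>u. u \<in> S \<Longrightarrow> (N has_field_derivative N1 u) (at u)"
    and r: "\<And>u. u \<in> S \<Longrightarrow> (r has_field_derivative r1 u) (at u)"
    and r1: "\<And>u. u \<in> S \<Longrightarrow> (r1 has_field_derivative r2 u) (at u)"
    and p: "\<And>u. u \<in> S \<Longrightarrow> (p has_field_derivative p1 u) (at u)"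
    and nz: "\<And>u. u \<in> S \<Longrightarrow> r u \<noteq> 0"
    and less: "\<And>u. u \<in> S \<Longrightarrow> norm (N u / r u ^ 3) < 1"
    and eq1: "\<And>u. u \<in> S \<Longrightarrow> c * p u * (N1 u * r u - 3 * N u * r1 u) = N u * (r u ^ 3 - N u)"
    and eq2: "\<And>u. u \<in> S \<Longrightarrow> 2 / 9 * (N1 u * r u - 3 * N u * r1 u) + 2 * c * p u * r1 u ^ 2
                = c * r u * (p1 u * r1 u + p u * r2 u) + c * q u * r u ^ 2"
  obtains H1 where
    "\<And>u. u \<in> S \<Longrightarrow> ((\<lambda>u. cubicF (N u / r u ^ 3) / r u) has_field_derivative H1 u) (at u)"
    "\<And>u. u \<in> S \<Longrightarrow> ((\<lambda>u. p u * H1 u) has_field_derivative q u * (cubicF (N u / r u ^ 3) / r u)) (at u)"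
proof
  define t where "t u = N u / r u ^ 3" for u
  define t1 where "t1 u = (N1 u * r u - 3 * N u * r1 u) / r u ^ 4" for u
  define H1 where "H1 u = cubicF' (t u) * t1 u / r u - cubicF (t u) * r1 u / r u ^ 2" for u
  have t: "(t has_field_derivative t1 u) (at u)" if "u \<in> S" for u
    unfolding t_def t1_def using nz[OF that]
    by (auto intro!: derivative_eq_intros N r that simp: field_simps eval_nat_numeral)
  have F: "((\<lambda>u. cubicF (t u)) has_field_derivative cubicF' (t u) * t1 u) (at u)" if "u \<in> S" for u
    using DERIV_chain2[OF cubicF_has_derivative t] less that by (simp add: t_def)
  have G: "((\<lambda>u. t u * (1 - t u) * cubicF' (t u)) has_field_derivative 2 / 9 * cubicF (t u) * t1 u) (at u)"
    if "u \<in> S" for u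
    using DERIV_chain2[OF cubicF_ode t] less that by (simp add: t_def)
  show "((\<lambda>u. cubicF (N u / r u ^ 3) / r u) has_field_derivative H1 u) (at u)" if "u \<in> S" for u
    unfolding t_def[symmetric] H1_def using nz[OF that]
    by (auto intro!: derivative_eq_intros F r that simp: field_simps power2_eq_square)
  have key: "c * p u * t1 u = t u * (1 - t u) * r u ^ 2" if "u \<in> S" for u
  proof -
    have "c * p u * t1 u = N u * (r u ^ 3 - N u) / r u ^ 4"
      by (simp add: t1_def flip: eq1[OF that])
    also have "\<dots> = t u * (1 - t u) * r u ^ 2"
      using nz[OF that] by (simp add: t_def field_simps eval_nat_numeral)
    finally show ?thesis .
  qed
  \<comment> \<open>In this form of \<open>p * H1\<close> the function \<open>cubicF'\<close> occurs
    only inside \<open>t (1 - t) F'(t)\<close>, whose derivative the hypergeometric equation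
    provides.\<close>
  define K where "K u = r u * (t u * (1 - t u) * cubicF' (t u)) / c - p u * r1 u / r u ^ 2 * cubicF (t u)" for u
  have pH1: "p u * H1 u = K u" if "u \<in> S" for u
  proof -
    have "p u * H1 u = p u * t1 u * cubicF' (t u) / r u - p u * r1 u / r u ^ 2 * cubicF (t u)"
      by (simp add: H1_def algebra_simps)
    also have "p u * t1 u = t u * (1 - t u) * r u ^ 2 / c"
      using key[OF that] \<open>c \<noteq> 0\<close> by (simp add: field_simps)
    also have "t u * (1 - t u) * r u ^ 2 / c * cubicF' (t u) / r u = r u * (t u * (1 - t u) * cubicF' (t u)) / c"
      using nz[OF that] by (simp add: power2_eq_square)
    finally show ?thesis
      by (simp only: K_def)
  qed
  show "((\<lambda>u. p u * H1 u) has_field_derivative q u * (cubicF (N u / r u ^ 3) / r u)) (at u)" if u: "u \<in> S" for u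
  proof (rule has_field_derivative_transform_within_open[OF _ \<open>open S\<close> u])
    define B where "B = ((p1 u * r1 u + p u * r2 u) * r u - 2 * p u * r1 u ^ 2) / r u ^ 3"
    have B: "((\<lambda>u. p u * r1 u / r u ^ 2) has_field_derivative B) (at u)"
      using nz[OF u] unfolding B_def
      by (auto intro!: derivative_eq_intros p r r1 u simp: field_simps eval_nat_numeral)
    have "(K has_field_derivative
        (r1 u * (t u * (1 - t u) * cubicF' (t u)) + 2 / 9 * cubicF (t u) * t1 u * r u) / c
        - (B * cubicF (t u) + cubicF' (t u) * t1 u * (p u * r1 u / r u ^ 2))) (at u)"
      unfolding K_def
      by (intro DERIV_diff DERIV_cdivide DERIV_mult B F G r u)
    also have "(r1 u * (t u * (1 - t u) * cubicF' (t u)) + 2 / 9 * cubicF (t u) * t1 u * r u) / c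
        - (B * cubicF (t u) + cubicF' (t u) * t1 u * (p u * r1 u / r u ^ 2))
      = (2 / 9 * t1 u * r u / c - B) * cubicF (t u)
        + r1 u * cubicF' (t u) / (c * r u ^ 2) * (t u * (1 - t u) * r u ^ 2 - c * p u * t1 u)"
      using nz[OF u] \<open>c \<noteq> 0\<close> by (simp add: field_simps)
    also have "\<dots> = (2 / 9 * t1 u * r u / c - B) * cubicF (t u)"
      using key[OF u] by simp
    also have "2 / 9 * t1 u * r u / c - B = q u / r u"
    proof -
      have "2 / 9 * t1 u * r u / c - B
        = (2 / 9 * (N1 u * r u - 3 * N u * r1 u) + 2 * c * p u * r1 u ^ 2
           - c * r u * (p1 u * r1 u + p u * r2 u)) / (c * r u ^ 3)"
        unfolding t1_def B_def using nz[OF u] \<open>c \<noteq> 0\<close> 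
        by (simp add: field_simps eval_nat_numeral)
      also have "\<dots> = q u / r u"
        unfolding eq2[OF u] using nz[OF u] \<open>c \<noteq> 0\<close> by (simp add: field_simps eval_nat_numeral)
      finally show ?thesis .
    qed
    finally show "(K has_field_derivative q u * (cubicF (N u / r u ^ 3) / r u)) (at u)"
      by (simp add: t_def)
  qed (simp add: pH1)
qed

lemma regular_singular_ode_unique:
  fixes A A1 B B1 p q :: "complex \<Rightarrow> complex"
  assumes S: "open S" "connected S" "0 \<in> S"
    and A: "\<And>u. u \<in> S \<Longrightarrow> (A has_field_derivative A1 u) (at u)"
      "\<And>u. u \<in> S \<Longrightarrow> ((\<lambda>u. p u * A1 u) has_field_derivative q u * A u) (at u)"
    and B: "\<And>u. u \<in> S \<Longrightarrow> (B has_field_derivative B1 u) (at u)"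
      "\<And>u. u \<in> S \<Longrightarrow> ((\<lambda>u. p u * B1 u) has_field_derivative q u * B u) (at u)"
    and p: "p 0 = 0" "\<And>u. u \<in> S \<Longrightarrow> u \<noteq> 0 \<Longrightarrow> p u \<noteq> 0"
    and nz: "\<And>u. u \<in> S \<Longrightarrow> B u \<noteq> 0"
    and eq: "A 0 = B 0" and u: "u \<in> S"
  shows "A u = B u"
proof -
  \<comment> \<open>\<open>p\<close> times the Wronskian is constant, and it vanishes at the singular point.\<close>
  define W where "W u = p u * A1 u * B u - p u * B1 u * A u" for u
  have W: "(W has_field_derivative 0) (at u)" if "u \<in> S" for u
    unfolding W_def
    using DERIV_diff[OF DERIV_mult[OF A(2)[OF that] B(1)[OF that]] DERIV_mult[OF B(2)[OF that] A(1)[OF that]]]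
    by (simp add: algebra_simps)
  have cW: "continuous_on S W"
    by (rule DERIV_continuous_on[OF has_field_derivative_at_within[OF W]])
  obtain c where c: "\<And>u. u \<in> S \<Longrightarrow> W u = c"
    using DERIV_zero_connected_constant[of S "{}" W] S cW W by auto
  have W0: "W u = 0" if "u \<in> S" for u
    using c[OF that] c[OF \<open>0 \<in> S\<close>] p by (simp add: W_def)
  have D: "((\<lambda>u. A u / B u) has_field_derivative (A1 u * B u - A u * B1 u) / (B u * B u)) (at u)"
    if "u \<in> S" for u
    using nz[OF that] by (intro DERIV_divide A B that)
  have cAB: "continuous_on S (\<lambda>u. A u / B u)"
    by (rule DERIV_continuous_on[OF has_field_derivative_at_within[OF D]])
  have "((\<lambda>u. A u / B u) has_field_derivative 0) (at u)" if "u \<in> S - {0}" for u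
  proof -
    have "p u * (A1 u * B u - A u * B1 u) = 0"
      using W0[of u] that by (simp add: W_def algebra_simps)
    then show ?thesis
      using D[of u] p(2)[of u] that by simp
  qed
  \<comment> \<open>The vanishing of \<open>p\<close> at 0 leaves the derivative of the quotient
    undetermined there; continuity bridges this one exceptional point.\<close>
  then obtain d where d: "\<And>u. u \<in> S \<Longrightarrow> A u / B u = d"
    using DERIV_zero_connected_constant[of S "{0}" "\<lambda>u. A u / B u"] S cAB by auto
  show ?thesis
    using d[OF u] d[OF \<open>0 \<in> S\<close>] nz[OF u] nz[OF \<open>0 \<in> S\<close>] eq by simp
qed

text \<open>Formally \<open>D = F(t) t' / t - N' / N\<close>, because \<open>Phi(t) + log t\<close>
  has derivative \<open>F(t) t' / t\<close> and \<open>log t = log N - 3 log r\<close>.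
  Multiplication by \<open>N\<close> keeps the formula valid at zeros of \<open>N\<close>.\<close>

lemma cubicPhi_pullback:
  fixes N r :: "complex \<Rightarrow> complex"
  assumes N: "(N has_field_derivative N1) (at u)" and r: "(r has_field_derivative r1) (at u)"
    and pos: "r u \<notin> \<real>\<^sub>\<le>\<^sub>0" and less: "norm (N u / r u ^ 3) < 1"
  obtains D where "((\<lambda>u. cubicPhi (N u / r u ^ 3) - 3 * Ln (r u)) has_field_derivative D) (at u)"
    "N u * D = cubicF (N u / r u ^ 3) / r u * (N1 * r u - 3 * N u * r1) - N1"
proof -
  have nz: "r u \<noteq> 0" using pos by auto
  obtain P where P: "(cubicPhi has_field_derivative P) (at (N u / r u ^ 3))"
      "N u / r u ^ 3 * P = cubicF (N u / r u ^ 3) - 1"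
    using cubicPhi_has_derivative[OF less] by blast
  have t: "((\<lambda>u. N u / r u ^ 3) has_field_derivative (N1 * r u - 3 * N u * r1) / r u ^ 4) (at u)"
    using nz by (auto intro!: derivative_eq_intros N r simp: field_simps eval_nat_numeral)
  have "((\<lambda>u. cubicPhi (N u / r u ^ 3) - 3 * Ln (r u)) has_field_derivative
      P * ((N1 * r u - 3 * N u * r1) / r u ^ 4) - 3 * (inverse (r u) * r1)) (at u)"
    by (intro DERIV_diff DERIV_cmult DERIV_chain2[OF P(1) t] DERIV_chain2[OF has_field_derivative_Ln r] pos)
  moreover have "N u * (P * ((N1 * r u - 3 * N u * r1) / r u ^ 4) - 3 * (inverse (r u) * r1))
     = N u / r u ^ 3 * P * ((N1 * r u - 3 * N u * r1) / r u) - 3 * N u * r1 / r u"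
    using nz by (simp add: field_simps eval_nat_numeral)
  moreover have "\<dots> = cubicF (N u / r u ^ 3) / r u * (N1 * r u - 3 * N u * r1) - N1"
    unfolding P(2) using nz by (simp add: field_simps)
  ultimately show ?thesis
    by (intro that) (simp_all only:)
qed

text \<open>Splitting \<open>ln |t| = ln |N| - 3 ln |r|\<close> lets the denominator be absorbed
  into a function that stays holomorphic where \<open>N\<close> vanishes.\<close>

lemma nfun_quotient_eq:
  assumes "N \<noteq> 0" "r \<noteq> 0" "norm (N / r ^ 3) < 1"
  shows "nfun (N / r ^ 3) = ln 3 - ln (norm N) / 3 - Re (cubicPhi (N / r ^ 3) - 3 * Ln r) / 3"
  using assms nfun_eq[of "N / r ^ 3"]
  by (simp add: norm_divide norm_power ln_div ln_realpow field_simps)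

section \<open>The common differential equation and its four parametrizations near the
  origin\<close>

lemma isCont_eventually_in_open:
  assumes "isCont f a" "open A" "f a \<in> A"
  shows "eventually (\<lambda>x. f x \<in> A) (nhds a)"
  using assms topological_tendstoD[of f "f a" "at a" A]
  by (simp add: isCont_def eventually_nhds_conv_at)

text \<open>At 0 and -1 each of the four arguments takes the value 0, and at 1, -1/2 and -2 the
  value 1; these two values are singular for the hypergeometric equation.\<close>

definition ode_lead :: "complex \<Rightarrow> complex" where
  "ode_lead u = u * (1 + u) * (1 - u) * (1 + 2 * u) * (2 + u)"

definition ode_lead' :: "complex \<Rightarrow> complex" where
  "ode_lead' u = 2 + 10 * u - 20 * u ^ 3 - 10 * u ^ 4"

definition ode_pot :: "complex \<Rightarrow> complex" where
  "ode_pot u = 8 * u ^ 3 + 12 * u ^ 2 - 2"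

lemma ode_lead_has_derivative: "(ode_lead has_field_derivative ode_lead' u) (at u)"
  unfolding ode_lead_def ode_lead'_def
  by (auto intro!: derivative_eq_intros simp: field_simps eval_nat_numeral)

text \<open>A parametrization \<open>t = N / r\<^sup>3\<close> along which \<open>F(t) / r\<close> solves
  \<open>(p H')' = q H\<close> with \<open>p = ode_lead\<close> and \<open>q = ode_pot\<close>. The functions \<open>l\<close> and \<open>M / r\<close> are
  \<open>u (1 + u)\<close> times the logarithmic derivatives of \<open>N\<close> and \<open>t\<close>.\<close>
locale cubic_param =
  fixes N N' r r' l M :: "complex \<Rightarrow> complex" and r'' c :: complex
  assumes N_deriv: "\<And>u. (N has_field_derivative N' u) (at u)"
    and r_deriv: "\<And>u. (r has_field_derivative r' u) (at u)"
    and r'_deriv: "\<And>u. (r' has_field_derivative r'') (at u)"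
    and N_0 [simp]: "N 0 = 0" and r_0 [simp]: "r 0 = 1" and c_nz: "c \<noteq> 0"
    and lead_eq: "\<And>u. c * ode_lead u * (N' u * r u - 3 * N u * r' u) = N u * (r u ^ 3 - N u)"
    and pot_eq: "\<And>u. 2 / 9 * (N' u * r u - 3 * N u * r' u) + 2 * c * ode_lead u * r' u ^ 2
        = c * r u * (ode_lead' u * r' u + ode_lead u * r'') + c * ode_pot u * r u ^ 2"
    and N_nz: "\<And>u. u \<noteq> 0 \<Longrightarrow> 1 + u \<noteq> 0 \<Longrightarrow> N u \<noteq> 0"
    and N_log_deriv: "\<And>u. u * (1 + u) * N' u = N u * l u"
    and quotient_log_deriv: "\<And>u. u * (1 + u) * (N' u * r u - 3 * N u * r' u) = N u * M u"
begin

definition H :: "complex \<Rightarrow> complex" where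
  "H u = cubicF (N u / r u ^ 3) / r u"

text \<open>This is \<open>Phi(t) + log t\<close> with its singular part \<open>log N\<close>
  removed.\<close>

definition L :: "complex \<Rightarrow> complex" where
  "L u = cubicPhi (N u / r u ^ 3) - 3 * Ln (r u)"

text \<open>\<open>Ln (r u)\<close> needs the slit plane, the series the unit disc, and the
  uniqueness argument a nonzero divisor. All three hold near 0, where \<open>r\<close>,
  \<open>t\<close> and \<open>H\<close> are close to 1, 0 and 1.\<close>

definition regular :: "complex \<Rightarrow> bool" where
  "regular u \<longleftrightarrow> r u \<notin> \<real>\<^sub>\<le>\<^sub>0 \<and> norm (N u / r u ^ 3) < 1 \<and> H u \<noteq> 0"

lemma H_0 [simp]: "H 0 = 1" and L_0 [simp]: "L 0 = 0"
  by (simp_all add: H_def L_def)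

lemma regular_nz: "regular u \<Longrightarrow> r u \<noteq> 0"
  by (auto simp: regular_def)

lemma eventually_regular: "eventually regular (nhds 0)"
proof -
  have r: "isCont r 0" and N: "isCont N 0"
    using r_deriv N_deriv by (blast intro: DERIV_isCont)+
  have t: "isCont (\<lambda>u. N u / r u ^ 3) 0"
    by (intro continuous_intros r N) simp
  have "isCont (\<lambda>u. cubicF (N u / r u ^ 3)) 0"
    by (rule isCont_o2[OF t]) (auto intro!: DERIV_isCont cubicF_has_derivative)
  then have H: "isCont H 0"
    unfolding H_def[abs_def] by (intro continuous_intros r) simp_all
  have "eventually (\<lambda>u. r u \<in> - \<real>\<^sub>\<le>\<^sub>0) (nhds 0)"
    by (intro isCont_eventually_in_open r) auto
  moreover have "eventually (\<lambda>u. N u / r u ^ 3 \<in> ball 0 1) (nhds 0)"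
    by (intro isCont_eventually_in_open t) auto
  moreover have "eventually (\<lambda>u. H u \<in> - {0}) (nhds 0)"
    by (intro isCont_eventually_in_open H) auto
  ultimately show ?thesis
    by eventually_elim (auto simp: regular_def)
qed

lemma H_ode:
  assumes "open S" "\<And>u. u \<in> S \<Longrightarrow> regular u"
  obtains H1 where "\<And>u. u \<in> S \<Longrightarrow> (H has_field_derivative H1 u) (at u)"
    "\<And>u. u \<in> S \<Longrightarrow> ((\<lambda>u. ode_lead u * H1 u) has_field_derivative ode_pot u * H u) (at u)"
proof -
  have "norm (N u / r u ^ 3) < 1" "r u \<noteq> 0" if "u \<in> S" for u
    using assms(2)[OF that] by (auto simp: regular_def)
  from cubicF_pullback_ode[OF assms(1) c_nz N_deriv r_deriv r'_deriv ode_lead_has_derivative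
      this(2) this(1) lead_eq pot_eq, folded H_def]
  show ?thesis
    using that by blast
qed

text \<open>Multiplying the formula for \<open>N u * D\<close> by \<open>u (1 + u)\<close> exposes a
  factor \<open>N u\<close> on both sides. Cancelling it requires \<open>N u\<close> to be nonzero;
  at 0 only differentiability is retained.\<close>

lemma L_has_derivative:
  assumes "regular u"
  obtains D where "(L has_field_derivative D) (at u)"
    "u \<noteq> 0 \<and> 1 + u \<noteq> 0 \<longrightarrow> u * (1 + u) * D = H u * M u - l u"
proof -
  have "r u \<notin> \<real>\<^sub>\<le>\<^sub>0" "norm (N u / r u ^ 3) < 1"
    using assms by (auto simp: regular_def)
  then obtain D where D: "(L has_field_derivative D) (at u)"
      "N u * D = H u * (N' u * r u - 3 * N u * r' u) - N' u"
    using cubicPhi_pullback[OF N_deriv r_deriv] unfolding L_def[abs_def] H_def by blast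
  have "u * (1 + u) * D = H u * M u - l u" if "u \<noteq> 0" "1 + u \<noteq> 0"
  proof -
    have "N u * (u * (1 + u) * D) = u * (1 + u) * (N u * D)"
      by (simp only: mult_ac)
    also have "\<dots> = H u * (u * (1 + u) * (N' u * r u - 3 * N u * r' u)) - u * (1 + u) * N' u"
      unfolding D(2) by (simp add: algebra_simps)
    also have "\<dots> = N u * (H u * M u - l u)"
      unfolding quotient_log_deriv N_log_deriv by (simp add: algebra_simps)
    finally show ?thesis
      using N_nz[OF that] by simp
  qed
  with D(1) show ?thesis by (intro that) auto
qed

lemma nfun_eq_L:
  assumes "regular u" "u \<noteq> 0" "1 + u \<noteq> 0"
  shows "nfun (N u / r u ^ 3) = ln 3 - ln (norm (N u)) / 3 - Re (L u) / 3"
  unfolding L_def using assms N_nz[of u] regular_nz[of u]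
  by (intro nfun_quotient_eq) (auto simp: regular_def)

end

text \<open>Both functions solve the equation given by \<open>ode_lead\<close> and
  \<open>ode_pot\<close> and equal 1 at 0; regularity of the second supplies the nonvanishing
  divisor.\<close>

lemma cubic_param_H_unique:
  assumes "cubic_param N N' r r' l M r'' c" "cubic_param n n' s s' k m s'' d"
    and S: "open S" "connected S" "0 \<in> S"
    and reg: "\<And>u. u \<in> S \<Longrightarrow> cubic_param.regular N r u" "\<And>u. u \<in> S \<Longrightarrow> cubic_param.regular n s u"
    and lead: "\<And>u. u \<in> S \<Longrightarrow> u \<noteq> 0 \<Longrightarrow> ode_lead u \<noteq> 0" and "u \<in> S"
  shows "cubic_param.H N r u = cubic_param.H n s u"
proof -
  interpret A: cubic_param N N' r r' l M r'' c by fact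
  interpret B: cubic_param n n' s s' k m s'' d by fact
  obtain A1 where A1: "\<And>u. u \<in> S \<Longrightarrow> (A.H has_field_derivative A1 u) (at u)"
    "\<And>u. u \<in> S \<Longrightarrow> ((\<lambda>u. ode_lead u * A1 u) has_field_derivative ode_pot u * A.H u) (at u)"
    using A.H_ode[OF S(1) reg(1)] by blast
  obtain B1 where B1: "\<And>u. u \<in> S \<Longrightarrow> (B.H has_field_derivative B1 u) (at u)"
    "\<And>u. u \<in> S \<Longrightarrow> ((\<lambda>u. ode_lead u * B1 u) has_field_derivative ode_pot u * B.H u) (at u)"
    using B.H_ode[OF S(1) reg(2)] by blast
  show ?thesis
    by (rule regular_singular_ode_unique[OF S A1 B1 _ lead _ _ \<open>u \<in> S\<close>])
       (use reg(2) in \<open>auto simp: ode_lead_def B.regular_def\<close>)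
qed

text \<open>Here and in the three other cases \<open>c = 1 / (2k)\<close>, where \<open>k\<close> is
  the order of vanishing of \<open>N\<close> at 0: comparing lowest-order terms in
  \<open>lead_eq\<close> forces this value.\<close>

interpretation P1: cubic_param "\<lambda>u. 27 / 2 * u * (1 + u) ^ 4" "\<lambda>u. 27 / 2 * ((1 + u) ^ 4 + 4 * u * (1 + u) ^ 3)"
  "\<lambda>u. 1 + 4 * u + u ^ 2" "\<lambda>u. 4 + 2 * u" "\<lambda>u. 1 + 5 * u"
  "\<lambda>u. (1 - u) ^ 3" "2" "1 / 2"
proof
  fix u :: complex
  show "((\<lambda>u. 27 / 2 * u * (1 + u) ^ 4) has_field_derivative 27 / 2 * ((1 + u) ^ 4 + 4 * u * (1 + u) ^ 3)) (at u)"
    by (auto intro!: derivative_eq_intros simp: field_simps eval_nat_numeral)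
  show "((\<lambda>u. 1 + 4 * u + u ^ 2) has_field_derivative 4 + 2 * u) (at u)"
    by (auto intro!: derivative_eq_intros simp: field_simps)
  show "((\<lambda>u. 4 + 2 * u) has_field_derivative 2) (at u)"
    by (auto intro!: derivative_eq_intros)
  show "27 / 2 * u * (1 + u) ^ 4 \<noteq> 0" if "u \<noteq> 0" "1 + u \<noteq> 0"
    using that by simp
\<comment> \<open>What remains are the values at 0, \<open>c_nz\<close> and the polynomial
  identities of the locale.\<close>
qed (simp_all add: ode_lead_def ode_lead'_def ode_pot_def field_simps eval_nat_numeral)

interpretation P2: cubic_param "\<lambda>u. - 27 / 2 * u * (1 + u)" "\<lambda>u. - 27 / 2 * (1 + 2 * u)"
  "\<lambda>u. 1 - 2 * u - 2 * u ^ 2" "\<lambda>u. - 2 - 4 * u" "\<lambda>u. 1 + 2 * u"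
  "\<lambda>u. (1 + 2 * u) ^ 3" "- 4" "1 / 2"
proof
  fix u :: complex
  show "((\<lambda>u. - 27 / 2 * u * (1 + u)) has_field_derivative - 27 / 2 * (1 + 2 * u)) (at u)"
    by (auto intro!: derivative_eq_intros simp: field_simps eval_nat_numeral)
  show "((\<lambda>u. 1 - 2 * u - 2 * u ^ 2) has_field_derivative - 2 - 4 * u) (at u)"
    by (auto intro!: derivative_eq_intros simp: field_simps)
  show "((\<lambda>u. - 2 - 4 * u) has_field_derivative - 4) (at u)"
    by (auto intro!: derivative_eq_intros)
  show "- 27 / 2 * u * (1 + u) \<noteq> 0" if "u \<noteq> 0" "1 + u \<noteq> 0"
    using that by simp
qed (simp_all add: ode_lead_def ode_lead'_def ode_pot_def field_simps eval_nat_numeral)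

text \<open>The normalization \<open>r 0 = 1\<close> requires
  \<open>2 + 2u - u^2 = 2 (1 + u - u^2 / 2)\<close>; the resulting factor \<open>2^3\<close> turns
  the constant \<open>27 / 2\<close> into \<open>27 / 16\<close>.\<close>

interpretation P3: cubic_param "\<lambda>u. 27 / 16 * u ^ 4 * (1 + u)" "\<lambda>u. 27 / 16 * (4 * u ^ 3 + 5 * u ^ 4)"
  "\<lambda>u. 1 + u - u ^ 2 / 2" "\<lambda>u. 1 - u" "\<lambda>u. 4 + 5 * u"
  "\<lambda>u. (2 + u) ^ 3 / 2" "- 1" "1 / 8"
proof
  fix u :: complex
  show "((\<lambda>u. 27 / 16 * u ^ 4 * (1 + u)) has_field_derivative 27 / 16 * (4 * u ^ 3 + 5 * u ^ 4)) (at u)"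
    by (auto intro!: derivative_eq_intros simp: field_simps eval_nat_numeral)
  show "((\<lambda>u. 1 + u - u ^ 2 / 2) has_field_derivative 1 - u) (at u)"
    by (auto intro!: derivative_eq_intros simp: field_simps)
  show "((\<lambda>u. 1 - u) has_field_derivative - 1) (at u)"
    by (auto intro!: derivative_eq_intros)
  show "27 / 16 * u ^ 4 * (1 + u) \<noteq> 0" if "u \<noteq> 0" "1 + u \<noteq> 0"
    using that by simp
qed (simp_all add: ode_lead_def ode_lead'_def ode_pot_def field_simps eval_nat_numeral)

interpretation P4: cubic_param "\<lambda>u. 27 / 4 * u ^ 2 * (1 + u) ^ 2" "\<lambda>u. 27 / 4 * (2 * u * (1 + u) ^ 2 + 2 * u ^ 2 * (1 + u))"
  "\<lambda>u. 1 + u + u ^ 2" "\<lambda>u. 1 + 2 * u" "\<lambda>u. 2 + 4 * u"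
  "\<lambda>u. (1 - u) * (1 + 2 * u) * (2 + u)" "2" "1 / 4"
proof
  fix u :: complex
  show "((\<lambda>u. 27 / 4 * u ^ 2 * (1 + u) ^ 2) has_field_derivative 27 / 4 * (2 * u * (1 + u) ^ 2 + 2 * u ^ 2 * (1 + u))) (at u)"
    by (auto intro!: derivative_eq_intros simp: field_simps eval_nat_numeral)
  show "((\<lambda>u. 1 + u + u ^ 2) has_field_derivative 1 + 2 * u) (at u)"
    by (auto intro!: derivative_eq_intros simp: field_simps)
  show "((\<lambda>u. 1 + 2 * u) has_field_derivative 2) (at u)"
    by (auto intro!: derivative_eq_intros)
  show "27 / 4 * u ^ 2 * (1 + u) ^ 2 \<noteq> 0" if "u \<noteq> 0" "1 + u \<noteq> 0"
    using that by simp
qed (simp_all add: ode_lead_def ode_lead'_def ode_pot_def field_simps eval_nat_numeral)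

section \<open>Constancy of the weighted sum of logarithms on a disc around 0\<close>

theorem mainTheorem6:
  shows "\<exists>\<epsilon>>0. \<forall>u::complex. 0 < cmod u \<and> cmod u < \<epsilon> \<longrightarrow>
    nfun (27 * u * (1 + u) ^ 4 / (2 * (1 + 4 * u + u ^ 2) ^ 3))
      + nfun (- (27 * u * (1 + u) / (2 * (1 - 2 * u - 2 * u ^ 2) ^ 3)))
    = 2 * nfun (27 * u ^ 4 * (1 + u) / (2 * (2 + 2 * u - u ^ 2) ^ 3))
      - 3 * nfun (27 * u ^ 2 * (1 + u) ^ 2 / (4 * (1 + u + u ^ 2) ^ 3))"
proof -
  \<comment> \<open>The radius \<open>1 / 2\<close> excludes the zeros 1, -1, -1/2 and -2 of
    \<open>ode_lead\<close> and keeps \<open>1 + u\<close> off the slit of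
    \<open>Ln\<close>.\<close>
  define good where "good u \<longleftrightarrow> P1.regular u \<and> P2.regular u \<and> P3.regular u \<and> P4.regular u \<and> norm u < 1 / 2" for u
  have "eventually (\<lambda>u :: complex. u \<in> ball 0 (1 / 2)) (nhds 0)"
    by (intro eventually_nhds_in_open) auto
  with P1.eventually_regular P2.eventually_regular P3.eventually_regular P4.eventually_regular
  have "eventually good (nhds 0)"
    by eventually_elim (simp add: good_def)
  then obtain \<epsilon> where \<epsilon>: "\<epsilon> > 0" "\<And>u. norm u < \<epsilon> \<Longrightarrow> good u"
    by (auto simp: eventually_nhds_metric)
  define S where "S = ball (0 :: complex) \<epsilon>"
  have S: "open S" "connected S" "0 \<in> S"
    using \<epsilon> by (auto simp: S_def)
  have good: "P1.regular u" "P2.regular u" "P3.regular u" "P4.regular u" "norm u < 1 / 2" if "u \<in> S" for u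
    using that \<epsilon>(2)[of u] by (simp_all add: S_def good_def)
  have slit: "1 + u \<notin> \<real>\<^sub>\<le>\<^sub>0" if "u \<in> S" for u
    using good(5)[OF that] abs_Re_le_cmod[of u] by (auto simp: complex_nonpos_Reals_iff)
  then have nz: "1 + u \<noteq> 0" if "u \<in> S" for u
    using that by force
  have lead: "ode_lead u \<noteq> 0" if "u \<in> S" "u \<noteq> 0" for u
  proof -
    have "norm (- 1 :: complex) = 1" "norm (- (1 / 2) :: complex) = 1 / 2" "norm (- 2 :: complex) = 2"
      by (simp_all add: norm_divide)
    then have "u \<noteq> 1" "u \<noteq> - 1" "u \<noteq> - (1 / 2)" "u \<noteq> - 2"
      using good(5)[OF that(1)] by auto
    then have "1 - u \<noteq> 0" "1 + u \<noteq> 0" "2 + u \<noteq> 0"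
      by (auto simp: add_eq_0_iff)
    moreover have "1 + 2 * u \<noteq> 0"
      using \<open>u \<noteq> - (1 / 2)\<close> by (auto simp: add_eq_0_iff field_simps)
    moreover note that(2)
    ultimately show ?thesis
      by (simp add: ode_lead_def)
  qed
  have H: "P1.H u = P4.H u" "P2.H u = P4.H u" "P3.H u = P4.H u" if "u \<in> S" for u
    by (rule cubic_param_H_unique[OF P1.cubic_param_axioms P4.cubic_param_axioms S good(1,4) lead that]
             cubic_param_H_unique[OF P2.cubic_param_axioms P4.cubic_param_axioms S good(2,4) lead that]
             cubic_param_H_unique[OF P3.cubic_param_axioms P4.cubic_param_axioms S good(3,4) lead that]; assumption)+
  \<comment> \<open>With weights 1, 1, -2, 3 the terms \<open>l u\<close> add up to
    \<open>9 u\<close>, and \<open>9 u / (u (1 + u))\<close> is the derivative of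
    \<open>9 Ln (1 + u)\<close>, which therefore compensates them.\<close>
  define E where "E u = P1.L u + P2.L u - 2 * P3.L u + 3 * P4.L u + 9 * Ln (1 + u)" for u
  have E: "\<exists>e. (E has_field_derivative e) (at u) \<and> (u \<noteq> 0 \<longrightarrow> e = 0)" if u: "u \<in> S" for u
  proof -
    obtain a where a: "(P1.L has_field_derivative a) (at u)"
        "u \<noteq> 0 \<and> 1 + u \<noteq> 0 \<longrightarrow> u * (1 + u) * a = P1.H u * (1 - u) ^ 3 - (1 + 5 * u)"
      by (rule P1.L_has_derivative[OF good(1)[OF u]], rule that)
    obtain b where b: "(P2.L has_field_derivative b) (at u)"
        "u \<noteq> 0 \<and> 1 + u \<noteq> 0 \<longrightarrow> u * (1 + u) * b = P2.H u * (1 + 2 * u) ^ 3 - (1 + 2 * u)"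
      by (rule P2.L_has_derivative[OF good(2)[OF u]], rule that)
    obtain c where c: "(P3.L has_field_derivative c) (at u)"
        "u \<noteq> 0 \<and> 1 + u \<noteq> 0 \<longrightarrow> u * (1 + u) * c = P3.H u * ((2 + u) ^ 3 / 2) - (4 + 5 * u)"
      by (rule P3.L_has_derivative[OF good(3)[OF u]], rule that)
    obtain d where d: "(P4.L has_field_derivative d) (at u)"
        "u \<noteq> 0 \<and> 1 + u \<noteq> 0 \<longrightarrow> u * (1 + u) * d = P4.H u * ((1 - u) * (1 + 2 * u) * (2 + u)) - (2 + 4 * u)"
      by (rule P4.L_has_derivative[OF good(4)[OF u]], rule that)
    have "((\<lambda>u. Ln (1 + u)) has_field_derivative inverse (1 + u)) (at u)"
      using slit[OF u] by (auto intro!: derivative_eq_intros simp: inverse_eq_divide)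
    then have "(E has_field_derivative a + b - 2 * c + 3 * d + 9 * inverse (1 + u)) (at u)"
      unfolding E_def[abs_def] by (intro DERIV_add DERIV_diff DERIV_cmult a(1) b(1) c(1) d(1))
    moreover have "a + b - 2 * c + 3 * d + 9 * inverse (1 + u) = 0" if "u \<noteq> 0"
    proof -
      define h where "h = P4.H u"
      have eqs: "u * (1 + u) * a = h * (1 - u) ^ 3 - (1 + 5 * u)"
        "u * (1 + u) * b = h * (1 + 2 * u) ^ 3 - (1 + 2 * u)"
        "u * (1 + u) * c = h * ((2 + u) ^ 3 / 2) - (4 + 5 * u)"
        "u * (1 + u) * d = h * ((1 - u) * (1 + 2 * u) * (2 + u)) - (2 + 4 * u)"
        using a(2) b(2) c(2) d(2) nz[OF u] that H[OF u] unfolding h_def by argo+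
      have "u * (1 + u) * (a + b - 2 * c + 3 * d + 9 * inverse (1 + u))
        = u * (1 + u) * a + u * (1 + u) * b - 2 * (u * (1 + u) * c) + 3 * (u * (1 + u) * d) + 9 * u"
        using nz[OF u] by (simp add: field_simps)
      also have "\<dots> = h * ((1 - u) ^ 3 + (1 + 2 * u) ^ 3 - (2 + u) ^ 3 + 3 * ((1 - u) * (1 + 2 * u) * (2 + u)))"
        unfolding eqs by (simp add: algebra_simps)
      \<comment> \<open>The identity for \<open>x^3 + y^3 + z^3\<close> with
        \<open>x = 1 - u\<close>, \<open>y = 1 + 2u\<close> and \<open>z = - (2 + u)\<close>, whose
        sum is 0.\<close>
      also have "(1 - u) ^ 3 + (1 + 2 * u) ^ 3 - (2 + u) ^ 3 + 3 * ((1 - u) * (1 + 2 * u) * (2 + u)) = 0"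
        by (simp add: algebra_simps eval_nat_numeral)
      finally show ?thesis
        using nz[OF u] that by simp
    qed
    ultimately show ?thesis by blast
  qed
  have "continuous_on S E"
    using E by (meson DERIV_isCont continuous_at_imp_continuous_on)
  moreover have "\<forall>u\<in>S - {0}. (E has_field_derivative 0) (at u)"
    using E by (metis DiffD1 DiffD2 singletonI)
  \<comment> \<open>The derivative was computed after division by \<open>u\<close>, so 0 is again an
    exceptional point covered by continuity.\<close>
  ultimately obtain e where e: "\<And>u. u \<in> S \<Longrightarrow> E u = e"
    using DERIV_zero_connected_constant[of S "{0}" E] S by blast
  have "E 0 = 0"
    unfolding E_def P1.L_0 P2.L_0 P3.L_0 P4.L_0 by simp
  then have E0: "E u = 0" if "u \<in> S" for u
    using e[OF that] e[OF S(3)] by simp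
  show ?thesis
  proof (intro exI conjI allI impI)
    fix u :: complex assume u: "0 < norm u \<and> norm u < \<epsilon>"
    then have uS: "u \<in> S" and u0: "u \<noteq> 0"
      by (auto simp: S_def)
    note nz = nz[OF uS]
    have log: "ln (norm (27 / 2 * u * (1 + u) ^ 4)) = ln (27 / 2) + ln (norm u) + 4 * ln (norm (1 + u))"
      "ln (norm (- 27 / 2 * u * (1 + u))) = ln (27 / 2) + ln (norm u) + ln (norm (1 + u))"
      "ln (norm (27 / 16 * u ^ 4 * (1 + u))) = ln (27 / 16) + 4 * ln (norm u) + ln (norm (1 + u))"
      "ln (norm (27 / 4 * u ^ 2 * (1 + u) ^ 2)) = ln (27 / 4) + 2 * ln (norm u) + 2 * ln (norm (1 + u))"
      using u0 nz by (simp_all add: norm_mult norm_power ln_mult ln_div ln_realpow)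
    note nfun = P1.nfun_eq_L[OF good(1)[OF uS] u0 nz] P2.nfun_eq_L[OF good(2)[OF uS] u0 nz]
      P3.nfun_eq_L[OF good(3)[OF uS] u0 nz] P4.nfun_eq_L[OF good(4)[OF uS] u0 nz]
    \<comment> \<open>A third of this constant cancels the \<open>ln 3\<close> terms of the four
      values, whose weights sum to 3. In the sum of logarithms the powers of \<open>|u|\<close>
      cancel and those of \<open>|1 + u|\<close> total 9, as in \<open>E\<close>.\<close>
    have "ln (27 / 2) + ln (27 / 2) - 2 * ln (27 / 16) + 3 * ln (27 / 4) = 9 * ln (3 :: real)"
    proof -
      have "ln 27 = 3 * ln (3 :: real)" "ln 16 = 4 * ln (2 :: real)" "ln 4 = 2 * ln (2 :: real)"
        using ln_realpow[of 3 3] ln_realpow[of 2 4] ln_realpow[of 2 2] by simp_all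
      then show ?thesis by (simp add: ln_div)
    qed
    moreover have "Re (P1.L u) + Re (P2.L u) - 2 * Re (P3.L u) + 3 * Re (P4.L u) + 9 * ln (norm (1 + u)) = 0"
      using arg_cong[OF E0[OF uS], of Re] nz by (simp add: E_def)
    ultimately have "nfun (27 / 2 * u * (1 + u) ^ 4 / (1 + 4 * u + u ^ 2) ^ 3)
        + nfun (- 27 / 2 * u * (1 + u) / (1 - 2 * u - 2 * u ^ 2) ^ 3)
        = 2 * nfun (27 / 16 * u ^ 4 * (1 + u) / (1 + u - u ^ 2 / 2) ^ 3)
        - 3 * nfun (27 / 4 * u ^ 2 * (1 + u) ^ 2 / (1 + u + u ^ 2) ^ 3)"
      unfolding nfun log by argo
    moreover have "27 / 16 * u ^ 4 * (1 + u) / (1 + u - u ^ 2 / 2) ^ 3 = 27 * u ^ 4 * (1 + u) / (2 * (2 + 2 * u - u ^ 2) ^ 3)"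
    proof -
      have "2 + 2 * u - u ^ 2 = 2 * (1 + u - u ^ 2 / 2)"
        by (simp add: field_simps)
      then show ?thesis
        by (simp only: power_mult_distrib) simp
    qed
    moreover have "27 / 2 * u * (1 + u) ^ 4 / (1 + 4 * u + u ^ 2) ^ 3 = 27 * u * (1 + u) ^ 4 / (2 * (1 + 4 * u + u ^ 2) ^ 3)"
      "- 27 / 2 * u * (1 + u) / (1 - 2 * u - 2 * u ^ 2) ^ 3 = - (27 * u * (1 + u) / (2 * (1 - 2 * u - 2 * u ^ 2) ^ 3))"
      "27 / 4 * u ^ 2 * (1 + u) ^ 2 / (1 + u + u ^ 2) ^ 3 = 27 * u ^ 2 * (1 + u) ^ 2 / (4 * (1 + u + u ^ 2) ^ 3)"
      by simp_all
    ultimately show "nfun (27 * u * (1 + u) ^ 4 / (2 * (1 + 4 * u + u ^ 2) ^ 3))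
        + nfun (- (27 * u * (1 + u) / (2 * (1 - 2 * u - 2 * u ^ 2) ^ 3)))
      = 2 * nfun (27 * u ^ 4 * (1 + u) / (2 * (2 + 2 * u - u ^ 2) ^ 3))
        - 3 * nfun (27 * u ^ 2 * (1 + u) ^ 2 / (4 * (1 + u + u ^ 2) ^ 3))"
      by (simp only:)
  qed (fact \<epsilon>(1))
qed

end
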